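(* Let $n\ge 1$. Then: (i) $F_{n,1}(1/2/3)=1$; (ii) $$F_{n,2}(1/2/3)=\sum_{l=1}^{n-1} r^{n-l}s^{l}+\sum_{l=2}^{n-1}\ \sum_{h=0}^{n-l-1}\ \sum_{i,j\ge 1}\binom{n-i-j-h-2}{l-i-j}\,q^{l-i}\,r^{n-l}\,s^{\,l-\delta_{h,0}j}\,t^{\,n-l-h},$$ where $\delta_{h,0}$ is the Kronecker delta.
   Context: A set partition $\pi=B_1/B_2/\cdots/B_k$ of $[n]=\{1,\dots,n\}$ is written with its blocks ordered so that $\min B_1<\min B_2<\cdots<\min B_k$. For $S\subseteq[n]$, restrict $\pi$ to $S$ by taking the nonempty intersections $B_i\cap S$, and standardize by replacing the smallest element of $S$ by $1$, the second smallest by $2$, etc. The partition $\pi$ contains a partition $\omega$ if the standardized restriction to some $S$ equals $\omega$; otherwise $\pi$ avoids $\omega$. $\Pi_{n,k}(\omega)$ is the set of partitions of $[n]$ with exactly $k$ blocks that avoid $\omega$. Here $1/2/3$ denotes the partition $\{\{1\},\{2\},\{3\}\}$ of $[3]$. The restricted growth function (RGF) of $\pi$ is the word $w(\pi)=a_1\cdots a_n$ with $a_i=j$ iff $i\in B_j$. For a word $w=a_1\cdots a_n$ put $lb(a_j)=\#\{a_i: i<j,\ a_i>a_j\}$, $ls(a_j)=\#\{a_i: i<j,\ a_i<a_j\}$, $rb(a_j)=\#\{a_i: i>j,\ a_i>a_j\}$, $rs(a_j)=\#\{a_i: i>j,\ a_i<a_j\}$, where each is the cardinality of a set of values (distinct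 letters are counted once), and let $lb(w)=\sum_j lb(a_j)$, and similarly for $ls,rb,rs$. For a partition $\pi$, $lb(\pi)=lb(w(\pi))$, etc. $$F_{n,k}(\omega)=F_{n,k}(\omega;q,r,s,t)=\sum_{\pi\in\Pi_{n,k}(\omega)}q^{lb(\pi)}r^{ls(\pi)}s^{rb(\pi)}t^{rs(\pi)}.$$ Binomial coefficient convention: $\binom{a}{0}=1$ for every integer $a$ (in particular $\binom{-1}{0}=1$), $\binom{a}{b}=0$ for $b<0$, and the usual value for $a\ge0$, $b\ge 0$. *)

theory Defs
  imports Main "HOL-Library.Disjoint_Sets" "HOL-Library.Groups_Big_Fun"
begin

definition restrict_part :: "nat set set \<Rightarrow> nat set \<Rightarrow> nat set set" where
  "restrict_part P S = {B \<inter> S |B. B \<in> P \<and> B \<inter> S \<noteq> {}}"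

text \<open>The order-preserving relabelling of a finite set \<open>S\<close> sends \<open>x\<close> to its rank in \<open>S\<close>,
  counted from 1.\<close>

definition standardize :: "nat set \<Rightarrow> nat set set \<Rightarrow> nat set set" where
  "standardize S Q = (\<lambda>B. (\<lambda>x. card {y \<in> S. y \<le> x}) ` B) ` Q"

definition contains_part :: "nat \<Rightarrow> nat set set \<Rightarrow> nat set set \<Rightarrow> bool" where
  "contains_part n P \<omega> \<longleftrightarrow> (\<exists>S \<subseteq> {1..n}. standardize S (restrict_part P S) = \<omega>)"

definition avoiders :: "nat \<Rightarrow> nat \<Rightarrow> nat set set \<Rightarrow> nat set set set" where
  "avoiders n k \<omega> =
     {P. partition_on {1..n} P \<and> card P = k \<and> \<not> contains_part n P \<omega>}"

text \<open>The block \<open>B\<^sub>j\<close> of the standard notation is \<open>blocks P ! (j - 1)\<close>.\<close>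

definition blocks :: "nat set set \<Rightarrow> nat set list" where
  "blocks P = sorted_key_list_of_set Min P"

definition rgf :: "nat \<Rightarrow> nat set set \<Rightarrow> nat list" where
  "rgf n P =
     map (\<lambda>i. THE j. 1 \<le> j \<and> j \<le> length (blocks P) \<and> i \<in> blocks P ! (j - 1)) [1..<Suc n]"

text \<open>The statistics count distinct values, not positions.\<close>

definition lb :: "nat list \<Rightarrow> nat" where
  "lb w = (\<Sum>j<length w. card {w ! i |i. i < j \<and> w ! i > w ! j})"

definition ls :: "nat list \<Rightarrow> nat" where
  "ls w = (\<Sum>j<length w. card {w ! i |i. i < j \<and> w ! i < w ! j})"

definition rb :: "nat list \<Rightarrow> nat" where
  "rb w = (\<Sum>j<length w. card {w ! i |i. j < i \<and> i < length w \<and> w ! i > w ! j})"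

definition rs :: "nat list \<Rightarrow> nat" where
  "rs w = (\<Sum>j<length w. card {w ! i |i. j < i \<and> i < length w \<and> w ! i < w ! j})"

text \<open>The generating polynomial, at arbitrary elements of an arbitrary commutative semiring;
  taking \<open>q r s t\<close> to be the indeterminates of a polynomial ring gives the formal polynomial.\<close>

definition F ::
    "nat \<Rightarrow> nat \<Rightarrow> nat set set \<Rightarrow> 'a \<Rightarrow> 'a \<Rightarrow> 'a \<Rightarrow> 'a \<Rightarrow> 'a::comm_semiring_1" where
  "F n k \<omega> q r s t =
     (\<Sum>P\<in>avoiders n k \<omega>.
        q ^ lb (rgf n P) * r ^ ls (rgf n P) * s ^ rb (rgf n P) * t ^ rs (rgf n P))"

text \<open>Binomial coefficients with integer arguments, where \<open>ibinom a 0 = 1\<close> for every \<open>a\<close>,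
  also negative. The value 0 for \<open>a < 0 < b\<close> is an arbitrary choice.\<close>

definition ibinom :: "int \<Rightarrow> int \<Rightarrow> nat" where
  "ibinom a b = (if b < 0 then 0 else if b = 0 then 1 else if a < 0 then 0 else nat a choose nat b)"

end

theory Submission
  imports Defs
begin

text \<open>
  No partition with at most two blocks contains \<open>1/2/3\<close>, so \<open>F\<^sub>n\<^sub>,\<^sub>2\<close> is a sum over the words in \<open>1\<close>
  and \<open>2\<close> that start with \<open>1\<close> and use both letters. Let \<open>l\<close> be the number of \<open>1\<close>s. Such a word is
  either \<open>1\<^sup>l 2\<^sup>n\<^sup>-\<^sup>l\<close>, or uniquely \<open>1\<^sup>i M 1\<^sup>j 2\<^sup>h\<close> with \<open>i, j \<ge> 1\<close> and \<open>M\<close> starting and ending with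
  \<open>2\<close>. The statistics depend only on \<open>(l, h, i, j)\<close>: on a two-letter word, \<open>lb\<close> counts the \<open>1\<close>s after
  the first \<open>2\<close> and \<open>ls\<close> the \<open>2\<close>s after the first \<open>1\<close>, while \<open>rb\<close> and \<open>rs\<close> are \<open>lb\<close> and \<open>ls\<close> of the
  reversed word. The binomial coefficient counts the possible \<open>M\<close>; its value at \<open>(-1, 0)\<close> accounts
  for the one-letter word \<open>M = 2\<close>, where the first and the last letter of \<open>M\<close> coincide.
\<close>

declare One_nat_def [simp del]

section \<open>The four statistics: reversal, appending a letter, two-letter words\<close>

lemma sum_card_before_rev:
  "(\<Sum>j<length w. card {rev w ! i |i. i < j \<and> R (rev w ! i) (rev w ! j)})
     = (\<Sum>j<length w. card {w ! i |i. j < i \<and> i < length w \<and> R (w ! i) (w ! j)})"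
proof -
  \<comment> \<open>Reversal moves position \<open>i\<close> to \<open>length w - Suc i\<close>,
    which turns earlier positions into later ones. The sum over \<open>j\<close> is reindexed by the
    same reflection afterwards.\<close>
  have eq: "{rev w ! i |i. i < j \<and> R (rev w ! i) (rev w ! j)}
      = {w ! i |i. length w - Suc j < i \<and> i < length w \<and> R (w ! i) (w ! (length w - Suc j))}"
    (is "?L = ?R") if "j < length w" for j
  proof (intro set_eqI iffI)
    fix x assume "x \<in> ?L"
    then obtain i where "x = rev w ! i" "i < j" "R (rev w ! i) (rev w ! j)"
      by blast
    then show "x \<in> ?R"
      using that by (auto simp: rev_nth intro!: exI[of _ "length w - Suc i"])
  next
    fix x assume "x \<in> ?R"
    then obtain i where "x = w ! i" "length w - Suc j < i" "i < length w"
      "R (w ! i) (w ! (length w - Suc j))"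
      by blast
    then show "x \<in> ?L"
      using that by (auto simp: rev_nth intro!: exI[of _ "length w - Suc i"])
  qed
  have "(\<Sum>j<length w. card {rev w ! i |i. i < j \<and> R (rev w ! i) (rev w ! j)})
      = (\<Sum>j<length w. card {w ! i |i. length w - Suc j < i \<and> i < length w
          \<and> R (w ! i) (w ! (length w - Suc j))})"
    by (intro sum.cong refl arg_cong[of _ _ card] eq) auto
  then show ?thesis
    using sum.nat_diff_reindex[of "\<lambda>j. card {w ! i |i. j < i \<and> i < length w \<and> R (w ! i) (w ! j)}"]
    by simp
qed

lemma lb_rev: "lb (rev w) = rb w"
  using sum_card_before_rev[of w "(>)"] by (simp add: lb_def rb_def)

lemma ls_rev: "ls (rev w) = rs w"
  using sum_card_before_rev[of w "(<)"] by (simp add: ls_def rs_def)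

text \<open>Each position looks only to its left, so appending a letter changes none of the earlier
  terms. Keeping \<open>R\<close> abstract serves \<open>lb\<close> and \<open>ls\<close> at
  once.\<close>

lemma sum_card_before_snoc:
  "(\<Sum>j<length (xs @ [y]). card {(xs @ [y]) ! i |i. i < j \<and> R ((xs @ [y]) ! i) ((xs @ [y]) ! j)})
     = (\<Sum>j<length xs. card {xs ! i |i. i < j \<and> R (xs ! i) (xs ! j)}) + card {x \<in> set xs. R x y}"
proof -
  have "{(xs @ [y]) ! i |i. i < j \<and> R ((xs @ [y]) ! i) ((xs @ [y]) ! j)}
      = {xs ! i |i. i < j \<and> R (xs ! i) (xs ! j)}" if "j < length xs" for j
  proof -
    \<comment> \<open>The case \<open>i = j\<close> is included because the letter at
      \<open>j\<close> itself takes part in the comparison.\<close>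
    have "(xs @ [y]) ! i = xs ! i" if "i \<le> j" for i
      using that \<open>j < length xs\<close> by (simp add: nth_append)
    then show ?thesis by (metis less_imp_le order_refl)
  qed
  moreover have "{(xs @ [y]) ! i |i. i < length xs \<and> R ((xs @ [y]) ! i) y} = {x \<in> set xs. R x y}"
    by (auto simp: nth_append in_set_conv_nth)
  ultimately show ?thesis by simp
qed

lemma lb_snoc: "lb (xs @ [y]) = lb xs + card {x \<in> set xs. x > y}"
  unfolding lb_def by (rule sum_card_before_snoc)

lemma ls_snoc: "ls (xs @ [y]) = ls xs + card {x \<in> set xs. x < y}"
  unfolding ls_def by (rule sum_card_before_snoc)

text \<open>Only a 1 can have a larger letter before it, and it has one exactly when some 2 precedes
  it. As values are counted once, its contribution is then 1, however many 2s there are.\<close>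

lemma lb_binary: "set w \<subseteq> {1, 2} \<Longrightarrow> lb w = count_list (dropWhile (\<lambda>x. x = 1) w) 1"
proof (induction w rule: rev_induct)
  case Nil
  then show ?case by (simp add: lb_def)
next
  case (snoc y xs)
  have gt: "{x \<in> set xs. x > y} = (if y = 1 \<and> 2 \<in> set xs then {2} else {})"
    using snoc.prems by auto
  show ?case
  proof (cases "2 \<in> set xs")
    case True
    \<comment> \<open>The leading run of 1s ends inside \<open>xs\<close>, so the new letter
      survives \<open>dropWhile\<close>; both sides grow by one exactly when it is a 1.\<close>
    then have "dropWhile (\<lambda>x. x = 1) (xs @ [y]) = dropWhile (\<lambda>x. x = 1) xs @ [y]"
      by (intro dropWhile_append1) auto
    then show ?thesis using snoc gt True by (auto simp: lb_snoc)
  next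
    case False
    then have "\<forall>x\<in>set xs. x = 1" using snoc.prems by auto
    then have "count_list (dropWhile (\<lambda>x. x = 1) xs) 1 = 0"
      "dropWhile (\<lambda>x. x = 1) (xs @ [y]) = (if y = 1 then [] else [y])"
      by (simp_all add: dropWhile_append dropWhile_eq_Nil_conv[THEN iffD2])
    then show ?thesis using snoc gt False by (auto simp: lb_snoc)
  qed
qed

lemma ls_binary: "set w \<subseteq> {1, 2} \<Longrightarrow> ls w = count_list (dropWhile (\<lambda>x. x = 2) w) 2"
proof (induction w rule: rev_induct)
  case Nil
  then show ?case by (simp add: ls_def)
next
  case (snoc y xs)
  have gt: "{x \<in> set xs. x < y} = (if y = 2 \<and> 1 \<in> set xs then {1} else {})"
    using snoc.prems by auto
  show ?case
  proof (cases "1 \<in> set xs")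
    case True
    then have "dropWhile (\<lambda>x. x = 2) (xs @ [y]) = dropWhile (\<lambda>x. x = 2) xs @ [y]"
      by (intro dropWhile_append1) auto
    then show ?thesis using snoc gt True by (auto simp: ls_snoc)
  next
    case False
    then have "\<forall>x\<in>set xs. x = 2" using snoc.prems by auto
    then have "count_list (dropWhile (\<lambda>x. x = 2) xs) 2 = 0"
      "dropWhile (\<lambda>x. x = 2) (xs @ [y]) = (if y = 2 then [] else [y])"
      by (simp_all add: dropWhile_append dropWhile_eq_Nil_conv[THEN iffD2])
    then show ?thesis using snoc gt False by (auto simp: ls_snoc)
  qed
qed

section \<open>Counting the middle words M\<close>

definition cores :: "nat \<Rightarrow> nat \<Rightarrow> nat list set" where
  "cores c d = {M. set M \<subseteq> {1, 2} \<and> count_list M 2 = c \<and> count_list M 1 = d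
     \<and> M \<noteq> [] \<and> hd M = 2 \<and> last M = 2}"

text \<open>Pascal's rule at the level of sets: the words are split by their first letter.\<close>

lemma binary_words_Suc_Suc:
  "{u. set u \<subseteq> {1, 2} \<and> count_list u 2 = Suc c \<and> count_list u 1 = Suc d}
     = (#) 1 ` {u. set u \<subseteq> {1, 2} \<and> count_list u 2 = Suc c \<and> count_list u 1 = d}
     \<union> (#) 2 ` {u. set u \<subseteq> {1, 2::nat} \<and> count_list u 2 = c \<and> count_list u 1 = Suc d}"
  (is "?L = ?R")
proof (intro set_eqI iffI)
  fix u assume "u \<in> ?L"
  then show "u \<in> ?R" by (cases u) (auto split: if_splits)
qed auto

lemma count_list_binary: "set u \<subseteq> {a, b} \<Longrightarrow> a \<noteq> b \<Longrightarrow> count_list u a + count_list u b = length u"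
  by (induction u) auto

lemma finite_binary_words: "finite {u. set u \<subseteq> {1, 2::nat} \<and> count_list u 2 = c \<and> count_list u 1 = d}"
  by (rule finite_subset[OF _ finite_lists_length_eq[of "{1, 2::nat}" "d + c"]])
     (auto dest: count_list_binary)

text \<open>The letters are left arbitrary so that the two boundary cases of Pascal's triangle, no
  1s and no 2s, are both instances.\<close>

lemma binary_words_0:
  assumes "a \<noteq> b"
  shows "{u. set u \<subseteq> {a, b} \<and> count_list u a = c \<and> count_list u b = 0} = {replicate c a}"
proof (intro set_eqI iffI)
  fix u assume "u \<in> {u. set u \<subseteq> {a, b} \<and> count_list u a = c \<and> count_list u b = 0}"
  then have "set u \<subseteq> {a}" "length u = c"
    using assms count_list_binary[of u a b] by (auto simp: count_list_0_iff)
  then show "u \<in> {replicate c a}"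
    by (metis insertI1 replicate_eqI singletonD subsetD)
next
  fix u assume "u \<in> {replicate c a}"
  moreover have "count_list (replicate c a) a = c" "count_list (replicate c a) b = 0"
    using assms by (induction c) auto
  ultimately show "u \<in> {u. set u \<subseteq> {a, b} \<and> count_list u a = c \<and> count_list u b = 0}"
    by auto
qed

lemma card_binary_words:
  "card {u. set u \<subseteq> {1, 2::nat} \<and> count_list u 2 = c \<and> count_list u 1 = d} = (c + d) choose d"
\<comment> \<open>The induction is on the length of the words, since removing the first letter may
  lower either \<open>c\<close> or \<open>d\<close>.\<close>
proof (induction "c + d" arbitrary: c d)
  case 0
  then show ?case using binary_words_0[of 2 "1::nat" c] by (simp add: insert_commute)
next
  case (Suc n)
  show ?case
  proof (cases "c = 0 \<or> d = 0")
    case True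
    then show ?thesis
      using binary_words_0[of 2 "1::nat" c] binary_words_0[of 1 "2::nat" d]
      by (auto simp: insert_commute conj_ac)
  next
    case False
    then obtain c' d' where [simp]: "c = Suc c'" "d = Suc d'"
      by (metis not0_implies_Suc)
    have "n = Suc c' + d'" "n = c' + Suc d'" using Suc(2) by auto
    note IH = Suc(1)[OF this(1)] Suc(1)[OF this(2)]
    show ?thesis
      unfolding \<open>c = _\<close> \<open>d = _\<close> binary_words_Suc_Suc
      by (subst card_Un_disjoint)
         (auto simp: card_image finite_binary_words IH)
  qed
qed

text \<open>For \<open>c >= 2\<close> the two outer 2s are distinct letters; stripping them leaves
  an arbitrary word with \<open>c - 2\<close> 2s and \<open>d\<close> 1s. For \<open>c = 1\<close>
  they are the same letter, so only \<open>[2]\<close> with \<open>d = 0\<close> is possible. The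
  formula then has upper index \<open>d - 1\<close>: the convention gives 1 at (-1, 0), and for
  \<open>d >= 1\<close> the value is 0.\<close>

lemma card_cores:
  assumes "c \<ge> 1"
  shows "card (cores c d) = ibinom (int c + int d - 2) (int d)"
proof (cases "c = 1")
  case True
  have "cores c d = (if d = 0 then {[2]} else {})"
  proof (intro set_eqI iffI)
    fix M assume M: "M \<in> cores c d"
    then obtain N where N: "M = 2 # N" by (cases M) (auto simp: cores_def)
    then have "N = []"
      using M True by (cases N rule: rev_cases) (auto simp: cores_def)
    then show "M \<in> (if d = 0 then {[2]} else {})" using M N by (auto simp: cores_def)
  qed (use True in \<open>auto simp: cores_def split: if_splits\<close>)
  then show ?thesis using True by (auto simp: ibinom_def)
next
  case False
  then obtain e where e: "c = Suc (Suc e)" using assms by (metis One_nat_def Suc_le_D not0_implies_Suc)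
  have "cores c d = (\<lambda>u. 2 # u @ [2]) ` {u. set u \<subseteq> {1, 2} \<and> count_list u 2 = e \<and> count_list u 1 = d}"
    (is "_ = ?R")
  proof (intro set_eqI iffI)
    fix M assume M: "M \<in> cores c d"
    then obtain N where N: "M = 2 # N" by (cases M) (auto simp: cores_def)
    then show "M \<in> ?R"
      using M e by (cases N rule: rev_cases) (auto simp: cores_def)
  qed (use e in \<open>auto simp: cores_def\<close>)
  moreover have "inj_on (\<lambda>u. 2 # u @ [2]) A" for A :: "nat list set" by (auto intro: inj_onI)
  ultimately have "card (cores c d) = (e + d) choose d"
    by (simp add: card_image card_binary_words)
  moreover have "nat (int c + int d - 2) = e + d" using e by simp
  ultimately show ?thesis using e by (auto simp: ibinom_def)
qed

section \<open>Statistics of glued and of sorted words\<close>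

lemma count_list_replicate: "count_list (replicate n x) y = (if x = y then n else 0)"
  by (induction n) auto

lemma dropWhile_replicate_append:
  "dropWhile P (replicate n x @ ys) = (if P x \<or> n = 0 then dropWhile P ys else replicate n x @ ys)"
  by (cases n) (auto simp: dropWhile_append)

definition two_words :: "nat \<Rightarrow> nat list set" where
  "two_words n = {w. length w = n \<and> set w = {1, 2} \<and> hd w = 1}"

definition glue :: "nat \<Rightarrow> nat \<Rightarrow> nat \<Rightarrow> nat list \<Rightarrow> nat list" where
  "glue h i j M = replicate i 1 @ M @ replicate j 1 @ replicate h 2"

lemma set_glue: "M \<in> cores c d \<Longrightarrow> set (glue h i j M) \<subseteq> {1, 2}"
  by (auto simp: glue_def cores_def)

lemma cores_Cons: "M \<in> cores c d \<Longrightarrow> M = 2 # tl M"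
  by (cases M) (auto simp: cores_def)

lemma rev_cores: "M \<in> cores c d \<Longrightarrow> rev M \<in> cores c d"
  by (auto simp: cores_def hd_rev last_rev)

text \<open>The first 2 opens \<open>M\<close>, so the 1s behind it are those of \<open>M\<close>
  and the block of length \<open>j\<close>. The reversed word is \<open>2^h 1^j (rev M) 1^i\<close>.
  If \<open>h > 0\<close>, its first 2 stands before the \<open>j\<close> 1s and they count for
  \<open>rb\<close>; if \<open>h = 0\<close>, they form its initial run and are dropped. This is the
  origin of the Kronecker delta. For \<open>rs\<close> the initial \<open>h\<close> 2s are dropped,
  which leaves those of \<open>M\<close>.\<close>

lemma stats_glue:
  assumes M: "M \<in> cores c d" and "i \<ge> 1" "j \<ge> 1"
  shows "lb (glue h i j M) = d + j" "ls (glue h i j M) = c + h"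
    "rb (glue h i j M) = i + d + (if h = 0 then 0 else j)" "rs (glue h i j M) = c"
proof -
  have counts: "count_list M 2 = c" "count_list M 1 = d" using M by (auto simp: cores_def)
  obtain N where N: "M = 2 # N" using cores_Cons[OF M] by blast
  obtain N' where N': "rev M = 2 # N'" using cores_Cons[OF rev_cores[OF M]] by blast
  have counts': "count_list (rev M) 2 = c" "count_list (rev M) 1 = d" using counts by auto
  have [simp]: "i \<noteq> 0" "j \<noteq> 0" using assms by auto
  show "lb (glue h i j M) = d + j"
    using lb_binary[OF set_glue[OF M]] counts N
    by (auto simp: glue_def count_list_replicate dropWhile_replicate_append)
  show "ls (glue h i j M) = c + h"
    using ls_binary[OF set_glue[OF M]] counts
    by (auto simp: glue_def count_list_replicate dropWhile_replicate_append)
  have set_rev: "set (rev (glue h i j M)) \<subseteq> {1, 2}" using set_glue[OF M] by simp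
  show "rb (glue h i j M) = i + d + (if h = 0 then 0 else j)"
    using lb_binary[OF set_rev] counts' N'
    by (auto simp: glue_def count_list_replicate dropWhile_replicate_append simp flip: lb_rev)
  show "rs (glue h i j M) = c"
    using ls_binary[OF set_rev] counts' N'
    by (auto simp: glue_def count_list_replicate dropWhile_replicate_append simp flip: ls_rev)
qed

lemma stats_sorted:
  assumes "l \<ge> 1" "m \<ge> 1"
  defines "w \<equiv> replicate l 1 @ replicate m (2::nat)"
  shows "lb w = 0" "ls w = m" "rb w = l" "rs w = 0"
proof -
  have set: "set w \<subseteq> {1, 2}" "set (rev w) \<subseteq> {1, 2}" by (auto simp: w_def)
  have [simp]: "l \<noteq> 0" "m \<noteq> 0" using assms by auto
  show "lb w = 0" "ls w = m" "rb w = l" "rs w = 0"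
    using lb_binary[OF set(1)] ls_binary[OF set(1)] lb_binary[OF set(2)] ls_binary[OF set(2)]
    by (auto simp: w_def count_list_replicate dropWhile_replicate_append
        dropWhile_eq_Nil_conv simp flip: lb_rev ls_rev)
qed

section \<open>Partitions with two blocks as words\<close>

definition word_part :: "nat list \<Rightarrow> nat set set" where
  "word_part w = {{p \<in> {1..length w}. w ! (p - 1) = 1}, {p \<in> {1..length w}. w ! (p - 1) = 2}}"

lemma blocks_pair:
  assumes "Min A < Min B"
  shows "blocks {A, B} = [A, B]"
proof -
  \<comment> \<open>\<open>sorted_key_list_of_set\<close> is a fold of
    \<open>insort_key Min\<close>, and its recursion equation requires insertions to commute. On
    \<open>{A, B}\<close> they do, because the two minima differ.\<close>
  interpret folding_on "{A, B}" "insort_key Min" "[]"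
  proof
    fix X Y assume "X \<in> {A, B}" "Y \<in> {A, B}"
    then show "insort_key Min Y \<circ> insort_key Min X = insort_key Min X \<circ> insort_key Min Y"
      using assms by (auto simp: insort_key_left_comm)
  qed
  show ?thesis
    using assms insert[of A "{B}"] insert[of B "{}"]
    by (cases "A = B") (auto simp: blocks_def sorted_key_list_of_set_def)
qed

text \<open>The leading 1 puts the element 1 into the first set, so its minimum is the smaller one
  and the order of the blocks agrees with the letters. As a left inverse, \<open>rgf n\<close> also
  shows that \<open>word_part\<close> is injective on these words.\<close>

lemma rgf_word_part:
  assumes w: "w \<in> two_words n"
  shows "rgf n (word_part w) = w"
proof -
  define A where "A = {p \<in> {1..n}. w ! (p - 1) = 1}"
  define B where "B = {p \<in> {1..n}. w ! (p - 1) = 2}"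
  have len: "length w = n" "set w = {1, 2}" "hd w = 1" using w by (auto simp: two_words_def)
  then have "w \<noteq> []" by auto
  then have w0: "w ! 0 = 1" "n > 0"
    using len hd_conv_nth[of w] by (metis, metis length_greater_0_conv)
  obtain k where k: "k < n" "w ! k = 2"
    using len in_set_conv_nth[of 2 w] by auto
  then have "Suc k \<in> B" by (auto simp: B_def)
  moreover have "1 \<in> A" using w0 by (auto simp: A_def)
  moreover have "finite A" "finite B" by (auto simp: A_def B_def)
  moreover have "p > 1" if "p \<in> B" for p
    using that w0 by (cases "p = 1") (simp_all add: B_def)
  moreover have "p \<ge> 1" if "p \<in> A" for p using that by (auto simp: A_def)
  ultimately have "Min A = 1" "Min B > 1"
    using Min_in[of B] by (blast intro: Min_eqI)+
  then have blocks: "blocks (word_part w) = [A, B]"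
    using blocks_pair[of A B] len by (simp add: word_part_def A_def B_def)
  have "(THE j. 1 \<le> j \<and> j \<le> length [A, B] \<and> p \<in> [A, B] ! (j - 1)) = w ! (p - 1)"
    if p: "p \<in> {1..n}" for p
  proof (rule the_equality)
    have "p - 1 < length w" using len(1) p by auto
    then have "w ! (p - 1) \<in> {1, 2}" using nth_mem[of "p - 1" w] len(2) by simp
    then show "1 \<le> w ! (p - 1) \<and> w ! (p - 1) \<le> length [A, B] \<and> p \<in> [A, B] ! (w ! (p - 1) - 1)"
      using p by (auto simp: A_def B_def)
    fix j assume j: "1 \<le> j \<and> j \<le> length [A, B] \<and> p \<in> [A, B] ! (j - 1)"
    then have "j = 1 \<or> j = 2" by auto
    then show "j = w ! (p - 1)" using j by (auto simp: A_def B_def)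
  qed
  then have "rgf n (word_part w) = map (\<lambda>p. w ! (p - 1)) [1..<Suc n]"
    unfolding rgf_def blocks by (intro map_cong) auto
  also have "\<dots> = w" using len by (intro nth_equalityI) (auto simp del: upt_Suc)
  finally show ?thesis .
qed

text \<open>Restriction and standardization are images of the set of blocks, so neither can increase
  the number of blocks.\<close>

lemma avoids_if_card_less:
  assumes "finite P" "card P < card \<omega>"
  shows "\<not> contains_part n P \<omega>"
proof -
  have "card (standardize S (restrict_part P S)) \<le> card P" for S
  proof -
    have "restrict_part P S \<subseteq> (\<lambda>B. B \<inter> S) ` P" by (auto simp: restrict_part_def)
    then have "standardize S (restrict_part P S)
        \<subseteq> (\<lambda>B. (\<lambda>x. card {y \<in> S. y \<le> x}) ` B) ` (\<lambda>B. B \<inter> S) ` P"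
      unfolding standardize_def by (rule image_mono)
    then show ?thesis
      using assms(1) by (meson card_image_le card_mono finite_imageI le_trans)
  qed
  then show ?thesis using assms(2) unfolding contains_part_def by (metis not_le)
qed

lemma avoiders_small:
  assumes "k < card \<omega>"
  shows "avoiders n k \<omega> = {P. partition_on {1..n} P \<and> card P = k}"
proof -
  have "finite P" if "partition_on {1..n} P" for P
    using that by (rule finite_elements[rotated]) simp
  then show ?thesis using avoids_if_card_less assms by (auto simp: avoiders_def)
qed

lemma word_part_two_words:
  assumes "n \<ge> 1"
  shows "word_part ` two_words n = {P. partition_on {1..n} P \<and> card P = 2}"
proof (intro set_eqI iffI)
  fix P assume "P \<in> word_part ` two_words n"
  then obtain w where w: "P = word_part w" "length w = n" "set w = {1, 2}"
    by (auto simp: two_words_def)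
  define A where "A = {p \<in> {1..n}. w ! (p - 1) = 1}"
  define B where "B = {p \<in> {1..n}. w ! (p - 1) = 2}"
  have P: "P = {A, B}" using w by (simp add: word_part_def A_def B_def)
  have "\<exists>p. p \<in> {1..n} \<and> w ! (p - 1) = x" if "x \<in> {1, 2}" for x
  proof -
    have "x \<in> set w" using that w(3) by simp
    then obtain k where "k < n" "w ! k = x"
      using w(2) unfolding in_set_conv_nth by blast
    then show ?thesis by (intro exI[of _ "Suc k"]) auto
  qed
  from this[of 1] this[of 2] have ne: "A \<noteq> {}" "B \<noteq> {}" unfolding A_def B_def by blast+
  moreover have disj: "A \<inter> B = {}" by (auto simp: A_def B_def)
  moreover have "A \<union> B = {1..n}"
  proof -
    have "w ! (p - 1) \<in> {1, 2}" if "p \<in> {1..n}" for p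
    proof -
      have "p - 1 < length w" using w(2) that by auto
      then show ?thesis using nth_mem[of "p - 1" w] w(3) by simp
    qed
    then show ?thesis unfolding A_def B_def by blast
  qed
  moreover have "A \<noteq> B" using ne disj by auto
  ultimately show "P \<in> {P. partition_on {1..n} P \<and> card P = 2}"
    by (auto simp: P partition_on_def disjoint_def)
next
  fix P assume "P \<in> {P. partition_on {1..n} P \<and> card P = 2}"
  then have P: "partition_on {1..n} P" "card P = 2" by auto
  then have "1 \<in> \<Union>P" using assms by (auto simp: partition_on_def)
  \<comment> \<open>\<open>A\<close> is taken to be the block of the element 1; marking its elements
    by the letter 1 makes the word start with 1.\<close>
  then obtain A where A: "A \<in> P" "1 \<in> A" by auto
  then obtain B where B: "P = {A, B}" "A \<noteq> B"
    using P(2) by (metis card_2_iff doubleton_eq_iff insertE singletonD)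
  have un: "A \<union> B = {1..n}" "A \<inter> B = {}" "B \<noteq> {}"
    using P(1) B by (auto simp: partition_on_def disjoint_def)
  define w where "w = map (\<lambda>p. if p \<in> A then 1 else 2::nat) [1..<Suc n]"
  have len: "length w = n" by (simp add: w_def)
  have nth: "w ! (p - 1) = (if p \<in> A then 1 else 2)" if "p \<in> {1..n}" for p
    using that by (auto simp: w_def simp del: upt_Suc)
  have "w \<noteq> []" using len assms by auto
  then have "hd w = 1" using nth[of 1] assms A by (simp add: hd_conv_nth)
  moreover have "set w = {1, 2}"
  proof
    show "{1, 2} \<subseteq> set w"
    proof -
      obtain b where "b \<in> B" using un by auto
      then have mem: "b \<in> {1..n} - A" "1 \<in> {1..n} \<inter> A" using un A assms by auto
      have "1 \<in> set w" unfolding w_def set_map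
        by (rule image_eqI[where x = 1]) (use mem in \<open>auto simp del: upt_Suc\<close>)
      moreover have "2 \<in> set w" unfolding w_def set_map
        by (rule image_eqI[where x = b]) (use mem in \<open>auto simp del: upt_Suc\<close>)
      ultimately show ?thesis by simp
    qed
  qed (auto simp: w_def)
  ultimately have "w \<in> two_words n" using len by (simp add: two_words_def)
  moreover have "word_part w = P"
  proof -
    have "{p \<in> {1..n}. w ! (p - 1) = 1} = {p \<in> {1..n}. p \<in> A}"
      "{p \<in> {1..n}. w ! (p - 1) = 2} = {p \<in> {1..n}. p \<notin> A}"
      using nth by (auto split: if_splits)
    moreover have "{p \<in> {1..n}. p \<in> A} = A" "{p \<in> {1..n}. p \<notin> A} = B"
      using un by blast+
    ultimately show ?thesis by (simp add: word_part_def len B)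
  qed
  ultimately show "P \<in> word_part ` two_words n" by blast
qed

section \<open>Generating polynomials for one and two blocks\<close>

definition weight :: "'a::comm_semiring_1 \<Rightarrow> 'a \<Rightarrow> 'a \<Rightarrow> 'a \<Rightarrow> nat list \<Rightarrow> 'a" where
  "weight q r s t w = q ^ lb w * r ^ ls w * s ^ rb w * t ^ rs w"

lemma F_two_blocks:
  assumes "n \<ge> 1" "2 < card \<omega>"
  shows "F n 2 \<omega> q r s t = (\<Sum>w\<in>two_words n. weight q r s t w)"
proof -
  have "inj_on word_part (two_words n)"
    by (rule inj_on_inverseI[of _ "rgf n"]) (rule rgf_word_part)
  then show ?thesis
    using assms by (simp add: F_def avoiders_small word_part_two_words[symmetric] sum.reindex
        rgf_word_part weight_def)
qed

lemma F_one_block: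
  assumes "n \<ge> 1" "1 < card \<omega>"
  shows "F n 1 \<omega> q r s t = 1"
proof -
  have "{P. partition_on {1..n} P \<and> card P = 1} = {{{1..n}}}"
  proof (intro set_eqI iffI)
    fix P assume "P \<in> {P. partition_on {1..n} P \<and> card P = 1}"
    then obtain B where "P = {B}" "\<Union>P = {1..n}"
      unfolding partition_on_def by (auto elim: card_1_singletonE)
    then show "P \<in> {{{1..n}}}" by simp
  next
    fix P assume "P \<in> {{{1..n}}}"
    then show "P \<in> {P. partition_on {1..n} P \<and> card P = 1}"
      using assms(1) by (auto simp: partition_on_def)
  qed
  moreover have "rgf n {{1..n}} = replicate n 1"
  proof -
    have blocks: "blocks {{1..n}} = [{1..n}]"
    proof -
      interpret folding_on "{{1..n}}" "insort_key Min" "[]" by standard auto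
      show ?thesis
        using insert[of "{1..n}" "{}"] by (simp add: blocks_def sorted_key_list_of_set_def)
    qed
    have "(THE j. 1 \<le> j \<and> j \<le> length [{1..n}] \<and> p \<in> [{1..n}] ! (j - 1)) = 1"
      if "p \<in> {1..n}" for p
      by (rule the_equality) (use that in auto)
    then have "rgf n {{1..n}} = map (\<lambda>_. 1) [1..<Suc n]"
      unfolding rgf_def blocks by (intro map_cong) auto
    then show ?thesis by (simp add: map_replicate_const)
  qed
  moreover have "lb (replicate n 1) = 0" "ls (replicate n 1) = 0"
    "rb (replicate n 1) = 0" "rs (replicate n 1) = 0"
    by (auto simp: lb_def ls_def rb_def rs_def)
  ultimately show ?thesis using assms by (simp add: F_def avoiders_small)
qed

section \<open>Unique decomposition of two-letter words\<close>

definition glue_params :: "nat \<Rightarrow> (nat \<times> nat \<times> (nat \<times> nat) \<times> nat list) set" where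
  "glue_params n = (SIGMA l:{2..n - 1}. SIGMA h:{0..n - l - 1}.
     SIGMA (i, j):{(i, j). 1 \<le> i \<and> 1 \<le> j \<and> i + j \<le> l}. cores (n - l - h) (l - i - j))"

text \<open>The ranges of \<open>l\<close> and \<open>h\<close> copy the summation bounds of the
  theorem. They reduce to \<open>l + h < n\<close>, as \<open>i, j >= 1\<close> and
  \<open>i + j <= l\<close> already force \<open>l >= 2\<close>.\<close>

lemma mem_glue_params:
  "(l, h, (i, j), M) \<in> glue_params n \<longleftrightarrow>
     l + h < n \<and> 1 \<le> i \<and> 1 \<le> j \<and> i + j \<le> l \<and> M \<in> cores (n - l - h) (l - i - j)"
  by (auto simp: glue_params_def)

definition glue_tuple :: "nat \<times> nat \<times> (nat \<times> nat) \<times> nat list \<Rightarrow> nat list" where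
  "glue_tuple = (\<lambda>(l, h, (i, j), M). glue h i j M)"

text \<open>All parameters are lengths of maximal runs. Since \<open>M\<close> starts with 2,
  \<open>i\<close> is the length of the initial run of 1s; since \<open>j >= 1\<close>,
  \<open>h\<close> is that of the final run of 2s. Once these are removed, \<open>j\<close> is the
  length of the final run of 1s, because \<open>M\<close> ends with 2.\<close>

lemma glue_inject:
  assumes eq: "glue h i j M = glue h' i' j' M'"
    and M: "M \<in> cores c d" and M': "M' \<in> cores c' d'"
    and j: "j \<ge> 1" and j': "j' \<ge> 1"
  shows "h = h' \<and> i = i' \<and> j = j' \<and> M = M'"
proof -
  have first: "length (takeWhile (\<lambda>x. x = 1) (glue h i j M)) = i" if "M \<in> cores c d" for c d h i j M
    by (subst cores_Cons[OF that]) (simp add: glue_def takeWhile_append)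
  have last: "length (takeWhile (\<lambda>x. x = 2) (rev (glue h i j M))) = h" if "j \<ge> 1" for h i j M
    using that by (cases j) (simp_all add: glue_def takeWhile_append)
  have mid: "takeWhile (\<lambda>x. x = 1) (rev M) = []" if "M \<in> cores c d" for M c d
    by (subst cores_Cons[OF rev_cores[OF that]]) simp
  have "i = i'" using first[OF M] first[OF M'] eq by metis
  moreover have "h = h'" using last[OF j] last[OF j'] eq by metis
  ultimately have eq': "replicate j 1 @ rev M = replicate j' 1 @ rev M'"
    using arg_cong[OF eq, of rev] by (simp add: glue_def)
  have "j = j'"
    using arg_cong[OF eq', of "\<lambda>x. length (takeWhile (\<lambda>x. x = 1) x)"]
    by (simp add: takeWhile_append mid[OF M] mid[OF M'])
  then have "M = M'" using eq' by simp
  then show ?thesis using \<open>i = i'\<close> \<open>h = h'\<close> \<open>j = j'\<close> by simp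
qed

lemma inj_on_glue: "inj_on glue_tuple (glue_params n)"
proof (rule inj_onI)
  fix x y assume xy: "x \<in> glue_params n" "y \<in> glue_params n" "glue_tuple x = glue_tuple y"
  obtain l h i j M where x: "x = (l, h, (i, j), M)" by (metis prod.exhaust)
  obtain l' h' i' j' M' where y: "y = (l', h', (i', j'), M')" by (metis prod.exhaust)
  have mem: "i + j \<le> l" "1 \<le> j" "M \<in> cores (n - l - h) (l - i - j)"
    "i' + j' \<le> l'" "1 \<le> j'" "M' \<in> cores (n - l' - h') (l' - i' - j')"
    using xy by (auto simp: x y mem_glue_params)
  have "glue h i j M = glue h' i' j' M'" using xy by (simp add: x y glue_tuple_def)
  then have "h = h' \<and> i = i' \<and> j = j' \<and> M = M'" using mem by (intro glue_inject)
  \<comment> \<open>\<open>glue_tuple\<close> ignores \<open>l\<close>, but \<open>l\<close> is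
    determined as the number of 1s in the glued word.\<close>
  moreover have "l = count_list M 1 + i + j" "l' = count_list M' 1 + i' + j'"
    using mem by (auto simp: cores_def)
  ultimately show "x = y" by (simp add: x y)
qed

lemma takeWhile_eq_replicate: "takeWhile (\<lambda>x. x = a) xs = replicate (length (takeWhile (\<lambda>x. x = a) xs)) a"
  by (induction xs) auto

lemma split_replicate:
  obtains k ys where "xs = replicate k a @ ys" "ys = [] \<or> hd ys \<noteq> a"
proof
  show "xs = replicate (length (takeWhile (\<lambda>x. x = a) xs)) a @ dropWhile (\<lambda>x. x = a) xs"
    unfolding takeWhile_eq_replicate[symmetric] by simp
  show "dropWhile (\<lambda>x. x = a) xs = [] \<or> hd (dropWhile (\<lambda>x. x = a) xs) \<noteq> a"
    using hd_dropWhile[of "\<lambda>x. x = a" xs] by blast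
qed

lemma split_replicate_end:
  obtains k ys where "xs = ys @ replicate k a" "ys = [] \<or> last ys \<noteq> a"
proof -
  obtain k ys where "rev xs = replicate k a @ ys" "ys = [] \<or> hd ys \<noteq> a"
    using split_replicate[of "rev xs" a] by blast
  then have "xs = rev ys @ replicate k a" "rev ys = [] \<or> last (rev ys) \<noteq> a"
    by (auto simp: last_rev rev_swap)
  then show ?thesis using that by blast
qed

text \<open>Existence comes from peeling off maximal runs: the initial 1s, the final 2s, then the 1s
  before these. If nothing is left after the second step, the word is sorted; otherwise the third
  step leaves \<open>M\<close>.\<close>

lemma two_words_eq:
  "two_words n = (\<lambda>l. replicate l 1 @ replicate (n - l) 2) ` {1..n - 1} \<union> glue_tuple ` glue_params n"
  (is "_ = ?S \<union> ?G")
proof (intro set_eqI iffI)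
  fix w assume w: "w \<in> two_words n"
  then have w': "length w = n" "set w = {1, 2}" "hd w = 1" by (auto simp: two_words_def)
  obtain i x where x: "w = replicate i 1 @ x" "x = [] \<or> hd x \<noteq> 1" by (rule split_replicate)
  have "x \<noteq> []"
  proof
    assume "x = []"
    then have "set w \<subseteq> {1}" using x(1) by auto
    then show False using w'(2) by auto
  qed
  then have i: "i \<ge> 1" using x w'(3) by (cases i) simp_all
  obtain y h where y: "x = y @ replicate h 2" "y = [] \<or> last y \<noteq> 2" by (rule split_replicate_end)
  show "w \<in> ?S \<union> ?G"
  proof (cases "y = []")
    case True
    have "i + h = n" using w'(1) unfolding x(1) y(1) True by simp
    moreover have "h \<ge> 1" using \<open>x \<noteq> []\<close> y True by (cases h) simp_all
    ultimately have "n - i = h" "i \<in> {1..n - 1}" using i by auto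
    moreover from this have "w = replicate i 1 @ replicate (n - i) 2" using x(1) y(1) True by simp
    ultimately show ?thesis by blast
  next
    case False
    obtain M j where M: "y = M @ replicate j 1" "M = [] \<or> last M \<noteq> 1" by (rule split_replicate_end)
    have sub: "set y \<subseteq> {1, 2}" using w'(2) unfolding x(1) y(1) by auto
    then have set: "set M \<subseteq> {1, 2}" unfolding M(1) by simp
    have "last y \<in> {1, 2}" "hd y \<in> {1, 2}"
      using sub last_in_set[OF False] hd_in_set[OF False] by blast+
    moreover have "last y \<noteq> 2" using y False by blast
    moreover have "hd y \<noteq> 1" using x(2) y(1) False by simp
    \<comment> \<open>Maximality of the two outer runs fixes both ends of \<open>y\<close>. Since
      they differ, \<open>M\<close> is nonempty and the run of 1s after it has length at least
      1.\<close>
    ultimately have ends: "last y = 1" "hd y = 2" by blast+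
    have "M \<noteq> []" using M(1) False ends(2) by (cases j) auto
    have "last M \<in> {1, 2}" using set last_in_set[OF \<open>M \<noteq> []\<close>] by blast
    then have "last M = 2" using M(2) \<open>M \<noteq> []\<close> by blast
    have "hd M = 2" using M(1) \<open>M \<noteq> []\<close> ends(2) by simp
    have "j \<ge> 1" using M(1) ends(1) \<open>last M = 2\<close> by (cases j) simp_all
    define l where "l = count_list w 1"
    have l: "l = i + j + count_list M 1"
      unfolding l_def x(1) y(1) M(1) by (simp add: count_list_replicate)
    have n: "n = l + h + count_list M 2"
      using count_list_binary[of M 1 2] set w'(1) l unfolding x(1) y(1) M(1) by simp
    have "count_list M 2 > 0"
      using \<open>hd M = 2\<close> \<open>M \<noteq> []\<close> by (cases M) auto
    then have "(l, h, (i, j), M) \<in> glue_params n"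
      using l n i \<open>j \<ge> 1\<close> set \<open>M \<noteq> []\<close> \<open>hd M = 2\<close> \<open>last M = 2\<close>
      unfolding mem_glue_params cores_def by simp
    moreover have "w = glue_tuple (l, h, (i, j), M)" using x y M by (simp add: glue_tuple_def glue_def)
    ultimately show ?thesis by blast
  qed
next
  fix w assume "w \<in> ?S \<union> ?G"
  then consider (sorted) l where "l \<in> {1..n - 1}" "w = replicate l 1 @ replicate (n - l) 2"
    | (unsorted) l h i j M where "(l, h, (i, j), M) \<in> glue_params n" "w = glue_tuple (l, h, (i, j), M)"
    by (auto simp: split_paired_Ex)
  then show "w \<in> two_words n"
  proof cases
    case sorted
    then have "l \<ge> 1" "n - l \<ge> 1" by auto
    then show ?thesis using sorted by (cases l) (auto simp: two_words_def)
  next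
    case unsorted
    have c: "M \<in> cores (n - l - h) (l - i - j)" and b: "l + h < n" "1 \<le> i" "1 \<le> j" "i + j \<le> l"
      using unsorted by (auto simp: mem_glue_params)
    have w: "w = glue h i j M" using unsorted by (simp add: glue_tuple_def)
    have "length M = (n - l - h) + (l - i - j)"
      using c count_list_binary[of M 1 2] by (auto simp: cores_def)
    then have "length w = n" using w b by (simp add: glue_def)
    moreover have "set w \<subseteq> {1, 2}" using set_glue[OF c] w by simp
    moreover have "hd w = 1" "1 \<in> set w" using b w by (cases i; auto simp: glue_def)+
    moreover have "2 \<in> set w" using arg_cong[OF cores_Cons[OF c], of set] w by (auto simp: glue_def)
    ultimately show ?thesis by (auto simp: two_words_def)
  qed
qed

section \<open>Summation over the decomposition\<close>

lemma finite_cores: "finite (cores c d)"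
  by (rule finite_subset[OF _ finite_binary_words[of c d]]) (auto simp: cores_def)

lemma finite_compositions: "finite {(i, j). 1 \<le> i \<and> 1 \<le> j \<and> i + j \<le> (l::nat)}"
  by (rule finite_subset[of _ "{..l} \<times> {..l}"]) auto

lemma sum_two_words:
  "(\<Sum>w\<in>two_words n. f w) = (\<Sum>l = 1..n - 1. f (replicate l 1 @ replicate (n - l) 2))
     + (\<Sum>l = 2..n - 1. \<Sum>h = 0..n - l - 1. \<Sum>(i, j)\<in>{(i, j). 1 \<le> i \<and> 1 \<le> j \<and> i + j \<le> l}.
         \<Sum>M\<in>cores (n - l - h) (l - i - j). f (glue h i j M))"
proof -
  let ?s = "\<lambda>l. replicate l 1 @ replicate (n - l) (2::nat)"
  have fin: "finite (glue_params n)"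
    by (auto simp: glue_params_def finite_cores finite_compositions intro!: finite_SigmaI)
  have "inj_on ?s {1..n - 1}"
    by (rule inj_on_inverseI[of _ "\<lambda>w. count_list w 1"]) (simp add: count_list_replicate)
  moreover have "?s ` {1..n - 1} \<inter> glue_tuple ` glue_params n = {}"
  proof -
    \<comment> \<open>The statistic \<open>lb\<close> separates the two families: it vanishes on
      sorted words and is at least \<open>j >= 1\<close> on glued ones.\<close>
    have "lb (?s l) = 0" if "l \<in> {1..n - 1}" for l
      using that by (intro stats_sorted) auto
    moreover have "lb (glue_tuple x) \<noteq> 0" if "x \<in> glue_params n" for x
      using that by (cases x) (auto simp: mem_glue_params glue_tuple_def stats_glue)
    ultimately show ?thesis by (metis (no_types, lifting) disjoint_iff imageE)
  qed
  ultimately have "(\<Sum>w\<in>two_words n. f w) = (\<Sum>l = 1..n - 1. f (?s l)) + (\<Sum>x\<in>glue_params n. f (glue_tuple x))"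
    unfolding two_words_eq using fin
    by (subst sum.union_disjoint) (auto simp: sum.reindex inj_on_glue)
  also have "(\<Sum>x\<in>glue_params n. f (glue_tuple x))
     = (\<Sum>l = 2..n - 1. \<Sum>h = 0..n - l - 1. \<Sum>(i, j)\<in>{(i, j). 1 \<le> i \<and> 1 \<le> j \<and> i + j \<le> l}.
         \<Sum>M\<in>cores (n - l - h) (l - i - j). f (glue h i j M))"
    unfolding glue_params_def
    using finite_compositions
    by (simp add: sum.Sigma finite_cores finite_SigmaI glue_tuple_def split_def)
  finally show ?thesis .
qed

(* Sum_any is the sum of a finitely supported family. The inner sum ranges over all i, j >= 1;
   the terms with i + j > l vanish because the lower binomial index is negative, so the truncated
   subtractions in the exponents are harmless. The case a < 0 < b of ibinom does not occur. *)
theorem theorem2p1: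
  fixes n :: nat and q r s t :: "'a::comm_semiring_1"
  assumes "n \<ge> 1"
  shows "F n 1 {{1}, {2}, {3}} q r s t = 1
    \<and> F n 2 {{1}, {2}, {3}} q r s t =
        (\<Sum>l = 1..n - 1. r ^ (n - l) * s ^ l)
      + (\<Sum>l = 2..n - 1. \<Sum>h = 0..n - l - 1.
          Sum_any (\<lambda>(i::nat, j::nat).
            if 1 \<le> i \<and> 1 \<le> j
            then of_nat (ibinom (int n - int i - int j - int h - 2) (int l - int i - int j))
                 * q ^ (l - i) * r ^ (n - l) * s ^ (l - (if h = 0 then j else 0)) * t ^ (n - l - h)
            else 0))"
proof -
  have "card {{1}, {2}, {3::nat}} = 3" by auto
  then have card: "1 < card {{1}, {2}, {3::nat}}" "2 < card {{1}, {2}, {3::nat}}" by linarith+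
  have sorted: "weight q r s t (replicate l 1 @ replicate (n - l) 2) = r ^ (n - l) * s ^ l"
    if "l \<in> {1..n - 1}" for l
  proof -
    have "l \<ge> 1" "n - l \<ge> 1" using that by auto
    then show ?thesis by (simp add: weight_def stats_sorted)
  qed
  have unsorted: "(\<Sum>(i, j)\<in>{(i, j). 1 \<le> i \<and> 1 \<le> j \<and> i + j \<le> l}.
        \<Sum>M\<in>cores (n - l - h) (l - i - j). weight q r s t (glue h i j M))
      = Sum_any (\<lambda>(i::nat, j::nat).
            if 1 \<le> i \<and> 1 \<le> j
            then of_nat (ibinom (int n - int i - int j - int h - 2) (int l - int i - int j))
                 * q ^ (l - i) * r ^ (n - l) * s ^ (l - (if h = 0 then j else 0)) * t ^ (n - l - h)
            else 0)" (is "?lhs = Sum_any ?g")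
    if "l \<in> {2..n - 1}" "h \<in> {0..n - l - 1}" for l h
  proof -
    let ?C = "{(i, j). 1 \<le> i \<and> 1 \<le> j \<and> i + j \<le> l}"
    \<comment> \<open>\<open>Sum_any\<close> has the default value 0 on infinite support, so the
      support is first enclosed in a finite set.\<close>
    have "{p. ?g p \<noteq> 0} \<subseteq> ?C"
      by (auto simp: ibinom_def split: if_splits)
    then have "Sum_any ?g = sum ?g ?C"
      by (rule Sum_any.expand_superset[OF finite_compositions])
    also have "\<dots> = ?lhs"
    proof (rule sum.cong)
      fix p assume "p \<in> ?C"
      then obtain i j where p: "p = (i, j)" and ij: "1 \<le> i" "1 \<le> j" "i + j \<le> l"
        by blast
      \<comment> \<open>The weight does not depend on the choice of \<open>M\<close>, so the inner
        sum is this monomial times the number of middle words.\<close>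
      have "weight q r s t (glue h i j M)
          = q ^ (l - i) * r ^ (n - l) * s ^ (l - (if h = 0 then j else 0)) * t ^ (n - l - h)"
        if M: "M \<in> cores (n - l - h) (l - i - j)" for M
      proof -
        have "l - i - j + j = l - i" "n - l - h + h = n - l"
          "i + (l - i - j) + (if h = 0 then 0 else j) = l - (if h = 0 then j else 0)"
          using ij \<open>l \<in> _\<close> \<open>h \<in> _\<close> by auto
        then show ?thesis unfolding weight_def stats_glue[OF M ij(1,2)] by simp
      qed
      moreover have "ibinom (int n - int i - int j - int h - 2) (int l - int i - int j)
          = card (cores (n - l - h) (l - i - j))"
      proof -
        \<comment> \<open>The natural differences are not truncated, by \<open>l + h < n\<close> and
          \<open>i + j <= l\<close>. In the upper index \<open>l\<close> cancels, which leaves the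
          form \<open>c + d - 2\<close> of \<open>card_cores\<close>.\<close>
        have c: "n - l - h \<ge> 1"
          and eqs: "int n - int i - int j - int h - 2 = int (n - l - h) + int (l - i - j) - 2"
            "int l - int i - int j = int (l - i - j)"
          using ij \<open>l \<in> _\<close> \<open>h \<in> _\<close> by auto
        show ?thesis by (simp only: eqs card_cores[OF c])
      qed
      ultimately show "?g p
          = (case p of (i, j) \<Rightarrow> \<Sum>M\<in>cores (n - l - h) (l - i - j). weight q r s t (glue h i j M))"
        using ij by (simp add: p mult.assoc)
    qed simp
    finally show ?thesis ..
  qed
  have "F n 2 {{1}, {2}, {3}} q r s t =
        (\<Sum>l = 1..n - 1. r ^ (n - l) * s ^ l)
      + (\<Sum>l = 2..n - 1. \<Sum>h = 0..n - l - 1.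
          Sum_any (\<lambda>(i::nat, j::nat).
            if 1 \<le> i \<and> 1 \<le> j
            then of_nat (ibinom (int n - int i - int j - int h - 2) (int l - int i - int j))
                 * q ^ (l - i) * r ^ (n - l) * s ^ (l - (if h = 0 then j else 0)) * t ^ (n - l - h)
            else 0))"
    unfolding F_two_blocks[OF assms card(2)] sum_two_words
    by (intro arg_cong2[of _ _ _ _ "(+)"] sum.cong refl sorted unsorted)
  then show ?thesis using F_one_block[OF assms card(1)] by blast
qed

end
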